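(* For every positive integer $n$ we have \[ \sum_{m\ge0} \frac{(2m+1)^2}{8}\,t^{\mathrm{e}-\mathrm{o},+}\left(n-T_m\right)=\sum_{d\mid n} (-1)^{d+1} d, \] where the left-hand sum runs over all integers $m\ge 0$ and the right-hand sum over the positive divisors $d$ of $n$.
   Context: For an integer $x\ge 0$ let $T_x:=\frac{x(x+1)}{2}$ be the $x$-th triangular number. For an integer $n$, let $t^{\mathrm{e},+}(n)$ (resp. $t^{\mathrm{o},+}(n)$) be the number of representations of $n$ as a sum $n=\sum_{j=1}^{\ell}T_{x_j}$ with $\ell\geq 0$ even (resp. odd) and all $x_j$ positive integers, i.e. the number of pairs consisting of an even (resp. odd) $\ell\ge 0$ and an ordered tuple $(x_1,\dots,x_\ell)$ of positive integers with $\sum_{j=1}^\ell T_{x_j}=n$. The empty tuple ($\ell=0$) counts as a representation of $0$, so $t^{\mathrm{e},+}(0)=1$ and $t^{\mathrm{o},+}(0)=0$; both functions vanish at negative integers. Set $t^{\mathrm{e}-\mathrm{o},+}(n):=t^{\mathrm{e},+}(n)-t^{\mathrm{o},+}(n)$. *)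

theory Defs
  imports Complex_Main
begin

definition triangular :: "nat \<Rightarrow> nat" where
  "triangular x = x * (x + 1) div 2"

text \<open>
  A representation of \<open>n\<close> as an ordered sum of positive triangular numbers is the list
  \<open>[x\<^sub>1, \<dots>, x\<^sub>l]\<close> of positive indices; its length is the number of summands.
  The set is empty for negative \<open>n\<close>, and it is \<open>{[]}\<close> for \<open>n = 0\<close>.
\<close>

definition triangular_reps :: "int \<Rightarrow> nat list set" where
  "triangular_reps n =
     {xs. (\<forall>x\<in>set xs. 0 < x) \<and> int (\<Sum>x\<leftarrow>xs. triangular x) = n}"

definition t_even :: "int \<Rightarrow> nat" where
  "t_even n = card {xs \<in> triangular_reps n. even (length xs)}"

definition t_odd :: "int \<Rightarrow> nat" where
  "t_odd n = card {xs \<in> triangular_reps n. odd (length xs)}"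

definition t_diff :: "int \<Rightarrow> int" where
  "t_diff n = int (t_even n) - int (t_odd n)"

text \<open>The cardinalities above are genuine counts: there are only finitely many representations.\<close>

lemma triangular_ge: "x \<le> triangular x"
proof (cases x)
  case (Suc k)
  have "x * 2 \<le> x * (x + 1)" using Suc by simp
  then have "x * 2 div 2 \<le> x * (x + 1) div 2" by (rule div_le_mono)
  then show ?thesis by (simp add: triangular_def)
qed simp

lemma finite_triangular_reps: "finite (triangular_reps n)"
proof -
  have "set xs \<subseteq> {..nat n} \<and> length xs \<le> nat n" if "xs \<in> triangular_reps n" for xs
  proof -
    from that have pos: "\<forall>x\<in>set xs. 0 < x"
      and total: "(\<Sum>x\<leftarrow>xs. triangular x) = nat n"
      by (auto simp: triangular_reps_def)
    have "x \<le> nat n" if "x \<in> set xs" for x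
      using member_le_sum_list[of "triangular x" "map triangular xs"] that triangular_ge[of x] total
      by simp
    moreover have "length xs \<le> (\<Sum>x\<leftarrow>xs. triangular x)"
      using pos
    proof (induction xs)
      case (Cons x xs)
      then show ?case using triangular_ge[of x] by simp
    qed simp
    ultimately show ?thesis using total by auto
  qed
  then have "triangular_reps n \<subseteq> {xs. set xs \<subseteq> {..nat n} \<and> length xs \<le> nat n}" by blast
  then show ?thesis by (rule finite_subset) (simp add: finite_lists_length_le)
qed

end

theory Submission
  imports Defs "HOL-Computational_Algebra.Formal_Power_Series"
begin

text \<open>
  Write \<open>T m\<close> for the \<open>m\<close>-th triangular number, \<open>\<psi> = \<Sum>m\<ge>0. X ^ T m\<close> and
  \<open>E = \<Sum>n\<ge>0. t_diff n * X ^ n\<close>. An ordered sum of \<open>l\<close> positive triangular numbers is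
  counted by \<open>(\<psi> - 1) ^ l\<close>, so \<open>E = \<Sum>l\<ge>0. (1 - \<psi>) ^ l = 1 / \<psi>\<close>. Coefficientwise this is
  obtained by splitting off the first summand (\<open>t_diff_recurrence\<close>).

  Since \<open>(2 * m + 1)\<^sup>2 / 8 = T m + 1 / 8\<close>, the generating function of the left-hand side is
  \<open>X * \<psi>' / \<psi> + 1 / 8\<close>. It remains to compute the logarithmic derivative of \<open>\<psi>\<close>. Gauss's
  product formula \<open>\<psi> = \<Prod>r\<ge>0. (1 - X ^ (2 * r + 2)) / (1 - X ^ (2 * r + 1))\<close> turns it into the
  Lambert series \<open>\<Sum>d\<ge>1. (- 1) ^ (d + 1) * d * X ^ d / (1 - X ^ d)\<close>, whose coefficients
  are the alternating divisor sums.

  Infinite products are avoided by means of a finite form of Gauss's formula due to Shanks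
  (\<open>gauss_finite\<close>), an identity valid in every commutative ring where the denominators
  are units, and proved by telescoping.
  It shows that the first \<open>2 * N\<close> terms of \<open>\<psi>\<close> agree with the first \<open>N\<close> factors of the
  product modulo \<open>X ^ (2 * N + 1)\<close>. All identities are therefore used as congruences modulo a
  power of \<open>X\<close> that exceeds the degree \<open>n\<close> of interest.
\<close>

unbundle fps_syntax

section \<open>A finite form of Gauss's product\<close>

lemma triangular_double: "triangular (2 * n) = n * (2 * n + 1)"
  by (simp add: triangular_def)

lemma triangular_Suc: "triangular (Suc n) = triangular n + Suc n"
  by (simp add: triangular_def)

text \<open>
  With \<open>g r\<close> the inverse of \<open>1 - q ^ (2 * r + 1)\<close>, this is the quotient of the \<open>n\<close>-th by the
  \<open>s\<close>-th partial product in Gauss's formula. Supplying \<open>g\<close> as a parameter makes sense of the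
  quotient in a ring without division.
\<close>

definition gauss_ratio :: "'a::comm_ring_1 \<Rightarrow> (nat \<Rightarrow> 'a) \<Rightarrow> nat \<Rightarrow> nat \<Rightarrow> 'a" where
  "gauss_ratio q g s n = (\<Prod>r=s..<n. (1 - q ^ (2 * r + 2)) * g r)"

text \<open>
  Passing from \<open>n\<close> to \<open>Suc n\<close> changes each summand on the right by a difference
  \<open>C (Suc s) - C s\<close>, so the total change collapses to a boundary term and the one new summand
  \<open>s = n\<close>. Together they are exactly the two new powers
  \<open>q ^ triangular (2 * n) + q ^ triangular (2 * n + 1)\<close>.
\<close>

lemma gauss_finite:
  fixes q :: "'a::comm_ring_1"
  assumes g: "\<And>r. (1 - q ^ (2 * r + 1)) * g r = 1"
  shows "(\<Sum>m<2 * n. q ^ triangular m) = (\<Sum>s<n. gauss_ratio q g s n * q ^ (s * (2 * n + 1)))"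
proof (induction n)
  case (Suc n)
  define C where "C s = gauss_ratio q g s n * (1 - q ^ (2 * s)) * q ^ (s * (2 * n + 1)) * g n" for s
  have telescope: "gauss_ratio q g s (Suc n) * q ^ (s * (2 * Suc n + 1))
      - gauss_ratio q g s n * q ^ (s * (2 * n + 1)) = C (Suc s) - C s" if "s < n" for s
  proof -
    let ?R = "gauss_ratio q g s n" and ?z = "q ^ (s * (2 * n + 1))"
    have R_Suc: "gauss_ratio q g s (Suc n) = ?R * ((1 - q ^ (2 * n + 2)) * g n)"
      using that by (simp add: gauss_ratio_def)
    have R_shift: "?R = (1 - q ^ (2 * s + 2)) * g s * gauss_ratio q g (Suc s) n"
      using that by (simp add: gauss_ratio_def prod.atLeast_Suc_lessThan)
    have R_step: "gauss_ratio q g (Suc s) n * (1 - q ^ (2 * s + 2)) = ?R * (1 - q ^ (2 * s + 1))"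
    proof -
      have "?R * (1 - q ^ (2 * s + 1))
          = gauss_ratio q g (Suc s) n * (1 - q ^ (2 * s + 2)) * ((1 - q ^ (2 * s + 1)) * g s)"
        by (simp only: R_shift mult_ac)
      then show ?thesis by (simp only: g mult_1_right)
    qed
    \<comment> \<open>Both \<open>C (Suc s)\<close> and \<open>C s\<close> become multiples of \<open>?R * ?z * g n\<close>, and the difference of
      their cofactors involves \<open>1 - q ^ (2 * n + 1)\<close>, which \<open>g n\<close> cancels.\<close>
    have "C (Suc s) = ?R * (1 - q ^ (2 * s + 1)) * q ^ (Suc s * (2 * n + 1)) * g n"
      using R_step by (simp add: C_def)
    also have "\<dots> = ?R * ?z * ((1 - q ^ (2 * s + 1)) * q ^ (2 * n + 1) * g n)"
      by (simp add: power_add algebra_simps)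
    finally have "C (Suc s) - C s
        = ?R * ?z * (((1 - q ^ (2 * s + 1)) * q ^ (2 * n + 1) - (1 - q ^ (2 * s))) * g n)"
      by (simp add: C_def algebra_simps)
    also have "(1 - q ^ (2 * s + 1)) * q ^ (2 * n + 1) - (1 - q ^ (2 * s))
        = q ^ (2 * s) * (1 - q ^ (2 * n + 2)) - (1 - q ^ (2 * n + 1))"
      by (simp add: power_add algebra_simps)
    also have "\<dots> * g n = q ^ (2 * s) * (1 - q ^ (2 * n + 2)) * g n - 1"
      by (subst left_diff_distrib) (simp only: g)
    finally have "C (Suc s) - C s = ?R * ?z * (q ^ (2 * s) * (1 - q ^ (2 * n + 2)) * g n - 1)" .
    moreover have "q ^ (s * (2 * Suc n + 1)) = ?z * q ^ (2 * s)"
      by (simp add: power_add[symmetric] algebra_simps)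
    ultimately show ?thesis by (simp only: R_Suc) (simp add: algebra_simps)
  qed
  have last: "gauss_ratio q g n (Suc n) = (1 - q ^ (2 * n + 2)) * g n"
    by (simp add: gauss_ratio_def)
  have "(\<Sum>s<Suc n. gauss_ratio q g s (Suc n) * q ^ (s * (2 * Suc n + 1)))
      - (\<Sum>s<n. gauss_ratio q g s n * q ^ (s * (2 * n + 1)))
      = (\<Sum>s<n. C (Suc s) - C s) + (1 - q ^ (2 * n + 2)) * g n * q ^ (n * (2 * Suc n + 1))"
    by (simp only: sum.lessThan_Suc last)
       (simp add: telescope[symmetric] sum_subtractf)
  also have "(\<Sum>s<n. C (Suc s) - C s) = C n - C 0"
    by (rule sum_lessThan_telescope)
  also have "C n - C 0 = (1 - q ^ (2 * n)) * q ^ (n * (2 * n + 1)) * g n"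
    by (simp add: C_def gauss_ratio_def)
  also have "q ^ (n * (2 * Suc n + 1)) = q ^ (n * (2 * n + 1)) * q ^ (2 * n)"
    by (simp add: power_add[symmetric] algebra_simps)
  also have "(1 - q ^ (2 * n)) * q ^ (n * (2 * n + 1)) * g n
      + (1 - q ^ (2 * n + 2)) * g n * (q ^ (n * (2 * n + 1)) * q ^ (2 * n))
      = q ^ (n * (2 * n + 1)) * (1 + q ^ (2 * n + 1)) * ((1 - q ^ (2 * n + 1)) * g n)"
    by (simp add: power_add algebra_simps)
  also have "(1 - q ^ (2 * n + 1)) * g n = 1" by (rule g)
  also have "q ^ (n * (2 * n + 1)) * (1 + q ^ (2 * n + 1)) * 1
      = q ^ triangular (2 * n) + q ^ triangular (Suc (2 * n))"
    by (simp only: triangular_Suc triangular_double)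
       (simp only: Suc_eq_plus1 power_add distrib_left mult_1_right)
  finally show ?case using Suc.IH by (simp add: algebra_simps)
qed simp

section \<open>The logarithmic derivative\<close>

text \<open>The power series of \<open>1 / (1 - X ^ d)\<close>.\<close>

definition geometric :: "nat \<Rightarrow> int fps" where
  "geometric d = Abs_fps (\<lambda>n. of_bool (d dvd n))"

lemma geometric_inverse:
  assumes "d > 0"
  shows "(1 - fps_X ^ d) * geometric d = 1"
proof (rule fps_ext)
  fix n
  show "((1 - fps_X ^ d) * geometric d) $ n = 1 $ n"
    using assms dvd_minus_self[of d n]
    by (auto simp: left_diff_distrib fps_X_power_mult_nth geometric_def dvd_imp_le of_bool_def)
qed

text \<open>
  The Euler operator multiplies the coefficient at \<open>X ^ n\<close> by \<open>n\<close>. Unlike the plain derivative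
  it preserves divisibility by \<open>X ^ k\<close>, so that congruences can be differentiated without
  loss. Logarithmic derivatives appear below in the division-free form \<open>euler f = f * l\<close>.
\<close>

definition euler :: "int fps \<Rightarrow> int fps" where
  "euler f = fps_X * fps_deriv f"

lemma euler_add: "euler (f + h) = euler f + euler h"
  by (simp add: euler_def algebra_simps)

lemma euler_mult: "euler (f * h) = euler f * h + f * euler h"
  by (simp add: euler_def algebra_simps)

lemma euler_X_power: "euler (fps_X ^ k) = of_nat k * fps_X ^ k"
proof (induction k)
  case (Suc k)
  then show ?case by (simp only: power_Suc euler_mult) (simp add: euler_def algebra_simps)
qed (simp add: euler_def)

lemma euler_sum: "euler (\<Sum>i\<in>A. f i) = (\<Sum>i\<in>A. euler (f i))"
  by (simp add: euler_def fps_deriv_sum sum_distrib_left)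

lemma euler_one_minus_X_power:
  assumes "d > 0"
  shows "euler (1 - fps_X ^ d) = (1 - fps_X ^ d) * (- of_nat d * fps_X ^ d * geometric d)"
proof -
  have "euler (1 - fps_X ^ d) = - euler (fps_X ^ d)" by (simp add: euler_def)
  also have "\<dots> = - of_nat d * fps_X ^ d * ((1 - fps_X ^ d) * geometric d)"
    using assms by (simp add: euler_X_power geometric_inverse)
  finally show ?thesis by (simp only: mult_ac)
qed

text \<open>Apply the product rule to \<open>(1 - X ^ d) * geometric d = 1\<close>.\<close>

lemma euler_geometric:
  assumes "d > 0"
  shows "euler (geometric d) = geometric d * (of_nat d * fps_X ^ d * geometric d)"
proof -
  let ?f = "1 - fps_X ^ d :: int fps" and ?g = "geometric d"
  have "0 = euler (?f * ?g) * ?g"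
    using assms by (simp add: geometric_inverse) (simp add: euler_def)
  also have "\<dots> = (euler ?f * ?g + ?f * euler ?g) * ?g" by (simp add: euler_mult)
  also have "\<dots> = (?f * ?g) * (- of_nat d * fps_X ^ d * ?g * ?g + euler ?g)"
    by (simp only: euler_one_minus_X_power[OF assms]) (simp add: algebra_simps)
  also have "\<dots> = euler ?g - ?g * (of_nat d * fps_X ^ d * ?g)"
    by (simp only: geometric_inverse[OF assms]) (simp add: algebra_simps)
  finally show ?thesis by simp
qed

text \<open>
  The partial sums of the Lambert series
  \<open>\<Sum>d\<ge>1. (- 1) ^ (d + 1) * d * X ^ d / (1 - X ^ d)\<close>.
\<close>

definition lambert :: "nat \<Rightarrow> int fps" where
  "lambert N = (\<Sum>d=1..N. (- 1) ^ (d + 1) * of_nat d * (fps_X ^ d * geometric d))"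

text \<open>
  Logarithmic derivatives of factors add up: the numerator \<open>1 - X ^ d\<close> (\<open>d\<close> even) contributes
  \<open>- d * X ^ d / (1 - X ^ d)\<close>, and the denominator \<open>1 - X ^ d\<close> (\<open>d\<close> odd) contributes the
  same expression with a plus sign.
\<close>

lemma euler_gauss_product:
  "euler (gauss_ratio fps_X (\<lambda>r. geometric (2 * r + 1)) 0 N)
    = gauss_ratio fps_X (\<lambda>r. geometric (2 * r + 1)) 0 N * lambert (2 * N)"
proof (induction N)
  case 0
  then show ?case by (simp add: gauss_ratio_def lambert_def) (simp add: euler_def)
next
  case (Suc N)
  let ?P = "gauss_ratio fps_X (\<lambda>r. geometric (2 * r + 1)) 0"
  define a where "a = (of_nat (2 * N + 1) * fps_X ^ (2 * N + 1) * geometric (2 * N + 1))"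
  define b where "b = (of_nat (2 * N + 2) * fps_X ^ (2 * N + 2) * geometric (2 * N + 2))"
  let ?f = "1 - fps_X ^ (2 * N + 2) :: int fps" and ?g = "geometric (2 * N + 1)"
  have L: "lambert (2 * Suc N) = lambert (2 * N) + a - b"
    by (simp add: lambert_def a_def b_def algebra_simps)
  have f: "euler ?f = ?f * (- b)"
    by (subst euler_one_minus_X_power) (simp_all only: b_def, simp_all add: algebra_simps)
  have g: "euler ?g = ?g * a"
    by (subst euler_geometric) (simp_all add: a_def)
  have P: "?P (Suc N) = ?P N * (?f * ?g)" by (simp add: gauss_ratio_def)
  show ?case unfolding P L euler_mult Suc.IH f g by (simp add: algebra_simps)
qed

lemma lambert_nth:
  assumes "0 < n" "n \<le> N"
  shows "lambert N $ n = (\<Sum>d | d dvd n. (- 1) ^ (d + 1) * int d)"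
proof -
  have summand: "((- 1) ^ (d + 1) * of_nat d * (fps_X ^ d * geometric d)) $ n
      = (if d dvd n then (- 1) ^ (d + 1) * int d else 0)" if "d > 0" for d
  proof -
    have "((- 1) ^ (d + 1) * of_nat d :: int fps) = fps_const ((- 1) ^ (d + 1) * int d)"
      by (simp add: fps_of_nat flip: fps_const_mult fps_const_power fps_const_neg)
    moreover have "(fps_X ^ d * geometric d) $ n = of_bool (d dvd n)"
      using that assms dvd_minus_self[of d n]
      by (auto simp: fps_X_power_mult_nth geometric_def of_bool_def dest: dvd_imp_le)
    ultimately show ?thesis by simp
  qed
  have "lambert N $ n = (\<Sum>d=1..N. if d dvd n then (- 1) ^ (d + 1) * int d else 0)"
    unfolding lambert_def fps_sum_nth by (intro sum.cong refl summand) simp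
  also have "\<dots> = (\<Sum>d\<in>{1..N} \<inter> {d. d dvd n}. (- 1) ^ (d + 1) * int d)"
    by (simp only: sum.inter_restrict finite_atLeastAtMost mem_Collect_eq)
  also have "{1..N} \<inter> {d. d dvd n} = {d. d dvd n}"
    using assms dvd_imp_le[of _ n] dvd_pos_nat[of n] by (force simp: Suc_le_eq)
  finally show ?thesis .
qed

text \<open>
  A truncation of Gauss's series \<open>\<psi>\<close>, with as many terms as \<open>gauss_finite\<close> describes. As
  \<open>m \<le> triangular m\<close>, it has the right coefficients at least below degree \<open>2 * N\<close>.
\<close>

definition theta :: "nat \<Rightarrow> int fps" where
  "theta N = (\<Sum>m<2 * N. fps_X ^ triangular m)"

text \<open>
  By \<open>gauss_finite\<close>, \<open>theta N\<close> is the \<open>N\<close>-th partial product (the summand \<open>s = 0\<close>) plus a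
  multiple \<open>Y\<close> of \<open>X ^ (2 * N + 1)\<close>; the Euler operator keeps \<open>Y\<close> such a multiple.
\<close>

lemma euler_theta_cong:
  "fps_X ^ (2 * N + 1) dvd euler (theta N) - theta N * lambert (2 * N)"
proof (cases N)
  case 0
  then show ?thesis by (simp add: theta_def euler_def)
next
  case (Suc M)
  let ?R = "gauss_ratio fps_X (\<lambda>r. geometric (2 * r + 1))"
  define rest where "rest = (\<Sum>s<M. ?R (Suc s) N * fps_X ^ (s * (2 * N + 1)))"
  define Y where "Y = fps_X ^ (2 * N + 1) * rest"
  have "theta N = (\<Sum>s<N. ?R s N * fps_X ^ (s * (2 * N + 1)))"
    unfolding theta_def by (rule gauss_finite) (rule geometric_inverse, simp)
  also have "\<dots> = ?R 0 N + Y"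
    unfolding Suc sum.lessThan_Suc_shift Y_def rest_def sum_distrib_left
    by (simp add: power_add algebra_simps)
  finally have theta: "theta N = ?R 0 N + Y" .
  have "euler (theta N) - theta N * lambert (2 * N) = euler Y - Y * lambert (2 * N)"
    unfolding theta euler_add euler_gauss_product by (simp add: algebra_simps)
  also have "euler Y = fps_X ^ (2 * N + 1) * (of_nat (2 * N + 1) * rest + euler rest)"
    unfolding Y_def euler_mult euler_X_power by (simp add: algebra_simps)
  also have "\<dots> - Y * lambert (2 * N)
      = fps_X ^ (2 * N + 1) * (of_nat (2 * N + 1) * rest + euler rest - rest * lambert (2 * N))"
    unfolding Y_def by (simp only: right_diff_distrib mult.assoc)
  finally show ?thesis by (metis dvd_triv_left)
qed

section \<open>Signed representations invert the theta series\<close>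

lemma t_diff_eq_signed_sum: "t_diff n = (\<Sum>xs\<in>triangular_reps n. (- 1) ^ length xs)"
proof -
  have "(\<Sum>xs\<in>triangular_reps n. (- 1 :: int) ^ length xs)
    = (\<Sum>xs\<in>triangular_reps n. of_bool (even (length xs)) - of_bool (odd (length xs)))"
    by (intro sum.cong refl) auto
  also have "\<dots> = t_diff n"
    by (simp add: sum_subtractf t_diff_def t_even_def t_odd_def finite_triangular_reps
        sum.inter_restrict Int_def of_bool_def flip: sum.inter_filter)
  finally show ?thesis by simp
qed

lemma t_diff_neg: "n < 0 \<Longrightarrow> t_diff n = 0"
proof -
  assume "n < 0"
  then have "triangular_reps n = {}" unfolding triangular_reps_def by auto
  then show ?thesis by (simp add: t_diff_eq_signed_sum)
qed

lemma t_diff_0: "t_diff 0 = 1"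
proof -
  have "triangular_reps 0 = {[]}"
  proof (intro equalityI subsetI)
    fix xs assume xs: "xs \<in> triangular_reps 0"
    show "xs \<in> {[]}"
    proof (cases xs)
      case (Cons x ys)
      then show ?thesis using xs triangular_ge[of x] by (auto simp: triangular_reps_def)
    qed simp
  qed (simp add: triangular_reps_def)
  then show ?thesis by (simp add: t_diff_eq_signed_sum)
qed

text \<open>
  Every representation of \<open>n > 0\<close> has a first summand \<open>triangular m\<close> with \<open>m > 0\<close>; removing it
  flips the sign. The term \<open>m = 0\<close> of the sum is \<open>t_diff n\<close> itself, so everything cancels.
  A larger \<open>N\<close> only adds zeros.
\<close>

lemma t_diff_recurrence:
  assumes "n > 0" "n < N"
  shows "(\<Sum>m<N. t_diff (int n - int (triangular m))) = 0"
proof -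
  let ?rest = "\<lambda>m. triangular_reps (int n - int (triangular m))"
  have decomp: "triangular_reps (int n) = (\<Union>m\<in>{0<..<N}. (#) m ` ?rest m)" (is "?L = ?R")
  proof (intro equalityI subsetI)
    fix xs assume xs: "xs \<in> ?L"
    then obtain m ys where "xs = m # ys"
      using assms by (cases xs) (auto simp: triangular_reps_def)
    with xs have "m > 0" "ys \<in> ?rest m" "triangular m \<le> n"
      by (auto simp: triangular_reps_def)
    moreover from this have "m < N" using triangular_ge[of m] assms by simp
    ultimately show "xs \<in> ?R" using \<open>xs = m # ys\<close> by auto
  qed (auto simp: triangular_reps_def)
  have "t_diff (int n) = (\<Sum>m\<in>{0<..<N}. \<Sum>xs\<in>(#) m ` ?rest m. (- 1) ^ length xs)"
    unfolding t_diff_eq_signed_sum decomp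
    by (intro sum.UNION_disjoint) (auto simp: finite_triangular_reps)
  also have "\<dots> = (\<Sum>m\<in>{0<..<N}. - t_diff (int n - int (triangular m)))"
    by (simp add: sum.reindex t_diff_eq_signed_sum sum_negf)
  finally have "t_diff (int n) + (\<Sum>m\<in>{0<..<N}. t_diff (int n - int (triangular m))) = 0"
    by (simp add: sum_negf)
  moreover have "{..<N} = insert 0 {0<..<N}" using assms by auto
  ultimately show ?thesis by (simp add: triangular_def)
qed

definition signed_reps :: "int fps" where
  "signed_reps = Abs_fps (\<lambda>n. t_diff (int n))"

lemma X_power_mult_signed_reps_nth:
  "(fps_X ^ k * signed_reps) $ n = t_diff (int n - int k)"
  by (auto simp: fps_X_power_mult_nth signed_reps_def t_diff_neg of_nat_diff)

lemma X_power_dvdI: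
  fixes f :: "'a::comm_ring_1 fps"
  assumes "\<And>n. n < k \<Longrightarrow> f $ n = 0"
  shows "fps_X ^ k dvd f"
proof
  show "f = fps_X ^ k * fps_shift k f"
    using assms by (intro fps_ext) (simp add: fps_X_power_mult_nth)
qed

lemma theta_signed_reps_cong: "fps_X ^ (2 * N) dvd theta N * signed_reps - 1"
proof (rule X_power_dvdI)
  fix n assume n: "n < 2 * N"
  have "(theta N * signed_reps) $ n = (\<Sum>m<2 * N. t_diff (int n - int (triangular m)))"
    by (simp add: theta_def sum_distrib_right fps_sum_nth X_power_mult_signed_reps_nth)
  also have "\<dots> = of_bool (n = 0)"
  proof (cases "n = 0")
    case True
    have "t_diff (int n - int (triangular m)) = of_bool (m = 0)" for m
      using True triangular_ge[of m] triangular_double[of 0]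
      by (cases "m = 0") (simp_all add: t_diff_0 t_diff_neg)
    with n True show ?thesis by (simp add: of_bool_def)
  next
    case False
    with n t_diff_recurrence show ?thesis by simp
  qed
  finally show "(theta N * signed_reps - 1) $ n = 0" by simp
qed

text \<open>
  Modulo \<open>X ^ (2 * N)\<close>, multiplying \<open>euler (theta N) = theta N * lambert (2 * N)\<close> by the
  inverse \<open>signed_reps\<close> of \<open>theta N\<close> leaves \<open>lambert (2 * N)\<close>. The claim compares the
  coefficients at \<open>X ^ n\<close>.
\<close>

lemma weighted_t_diff_sum:
  assumes "0 < n" "n < 2 * N"
  shows "(\<Sum>m<2 * N. int (triangular m) * t_diff (int n - int (triangular m)))
    = (\<Sum>d | d dvd n. (- 1) ^ (d + 1) * int d)"
proof -
  have 1: "fps_X ^ (2 * N) dvd (euler (theta N) - theta N * lambert (2 * N)) * signed_reps"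
    using euler_theta_cong[of N] by (intro dvd_mult2) (metis le_add1 le_imp_power_dvd dvd_trans)
  have 2: "fps_X ^ (2 * N) dvd (theta N * signed_reps - 1) * lambert (2 * N)"
    using theta_signed_reps_cong by (intro dvd_mult2)
  have "fps_X ^ (2 * N) dvd euler (theta N) * signed_reps - lambert (2 * N)"
    using dvd_add[OF 1 2] by (simp add: algebra_simps)
  then obtain k where k: "euler (theta N) * signed_reps - lambert (2 * N) = fps_X ^ (2 * N) * k" ..
  have "(euler (theta N) * signed_reps - lambert (2 * N)) $ n = 0"
    unfolding k using assms by (simp add: fps_X_power_mult_nth)
  then have "(euler (theta N) * signed_reps) $ n = lambert (2 * N) $ n" by simp
  moreover have "euler (theta N) * signed_reps
      = (\<Sum>m<2 * N. fps_const (int (triangular m)) * (fps_X ^ triangular m * signed_reps))"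
    by (simp add: theta_def euler_sum euler_X_power sum_distrib_right fps_of_nat mult.assoc)
  ultimately show ?thesis
    using assms by (simp add: fps_sum_nth X_power_mult_signed_reps_nth lambert_nth)
qed

theorem theorem1p2:
  fixes n :: nat
  assumes "n > 0"
  shows "(\<lambda>m::nat. (2 * real m + 1)\<^sup>2 / 8 * real_of_int (t_diff (int n - int (triangular m))))
           sums (\<Sum>d | d dvd n. (- 1) ^ (d + 1) * real d)"
proof -
  define t where "t m = t_diff (int n - int (triangular m))" for m
  have weight: "(2 * real m + 1)\<^sup>2 / 8 = real (triangular m) + 1 / 8" for m
  proof -
    have "2 * triangular m = m * (m + 1)" by (simp add: triangular_def)
    then have "2 * real (triangular m) = real m * (real m + 1)"
      by (metis of_nat_1 of_nat_add of_nat_mult of_nat_numeral)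
    then show ?thesis by (simp add: power2_eq_square field_simps)
  qed
  have "(\<lambda>m. (2 * real m + 1)\<^sup>2 / 8 * real_of_int (t m))
      sums (\<Sum>m<2 * n. (2 * real m + 1)\<^sup>2 / 8 * real_of_int (t m))"
  proof (rule sums_finite)
    fix m assume "m \<notin> {..<2 * n}"
    then have "int n - int (triangular m) < 0" using triangular_ge[of m] assms by simp
    then show "(2 * real m + 1)\<^sup>2 / 8 * real_of_int (t m) = 0" by (simp add: t_def t_diff_neg)
  qed simp
  also have "(\<Sum>m<2 * n. (2 * real m + 1)\<^sup>2 / 8 * real_of_int (t m))
      = real_of_int (\<Sum>m<2 * n. int (triangular m) * t m) + real_of_int (\<Sum>m<2 * n. t m) / 8"
    by (simp add: weight distrib_right sum.distrib sum_divide_distrib)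
  \<comment> \<open>The constant part \<open>1 / 8\<close> of the weight contributes nothing since \<open>n > 0\<close>.\<close>
  also have "(\<Sum>m<2 * n. t m) = 0"
    unfolding t_def using assms by (intro t_diff_recurrence) auto
  also have "(\<Sum>m<2 * n. int (triangular m) * t m) = (\<Sum>d | d dvd n. (- 1) ^ (d + 1) * int d)"
    unfolding t_def using assms by (intro weighted_t_diff_sum) auto
  finally show ?thesis by (simp add: t_def)
qed

end
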